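(* Let $n$ be a positive integer and let $A$ be a set with $\{1, 3, \ldots, 2n-1\} \subset A \subseteq \{1, 2, \ldots, 2n\}$ and $|A| \ge n+4$. Then there exist pairwise distinct integers $b_1, b_2, b_3, b_4, b_5$ such that $b_i + b_j \in A$ for all $1 \le i < j \le 5$.
   Context: The integers $b_i$ are arbitrary integers (not required to be positive or to lie in $A$). *)

theory Defs
  imports Main
begin

end

theory Submission
  imports Defs
begin

text \<open>
  Look for three \<open>b\<^sub>i\<close> of one parity and two of the other. The mixed sums are odd, so they only have
  to lie in \<open>{1..2n-1}\<close>. For half-values \<open>p < q < r\<close> of even elements of \<open>A\<close>, the numbers
  \<open>p+q-r\<close>, \<open>p+r-q\<close>, \<open>q+r-p\<close> have pairwise sums \<open>2p\<close>, \<open>2q\<close>, \<open>2r\<close>; for a half-value \<open>e\<close> (possibly one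
  of \<open>p\<close>, \<open>q\<close>, \<open>r\<close>) the numbers \<open>e-d\<close>, \<open>e+d\<close> have sum \<open>2e\<close>, where \<open>d\<close> is \<open>1\<close> or \<open>2\<close> according to
  parity. Since \<open>A\<close> has four even elements \<open>2w < 2x < 2y < 2z\<close>, one of the choices
  \<open>(p,q,r;e) = (x,y,z;w)\<close>, \<open>(w,x,y;z)\<close>, \<open>(w,x,y;y)\<close> satisfies the range conditions.
\<close>

text \<open>The relation given to \<open>sorted_wrt\<close> is not an order; it only ranges over
  pairs of positions, and it splits along \<open>@\<close> into a triple, a pair and mixed
  sums.\<close>

lemma five_numbers_from_list:
  fixes A :: "int set"
  assumes "length bs = 5" "distinct bs" "sorted_wrt (\<lambda>u v. u + v \<in> A) bs"
  shows "\<exists>b :: nat \<Rightarrow> int. inj_on b {1..5} \<and>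
           (\<forall>i j. 1 \<le> i \<and> i < j \<and> j \<le> 5 \<longrightarrow> b i + b j \<in> A)"
proof (intro exI conjI allI impI)
  show "inj_on (\<lambda>i. bs ! (i - 1)) {1..5}"
    using assms(1,2) by (auto intro!: inj_onI simp: nth_eq_iff_index_eq)
  show "bs ! (i - 1) + bs ! (j - 1) \<in> A" if "1 \<le> i \<and> i < j \<and> j \<le> 5" for i j
    using that assms(1) by (intro sorted_wrt_nth_less[OF assms(3)]) auto
qed

text \<open>The extreme mixed sums are \<open>(p + q - r) + (e - d)\<close> and
  \<open>(q + r - p) + (e + d)\<close>, which \<open>lower\<close> and \<open>upper\<close> bound.
  Oddness of mixed sums also keeps the triple disjoint from the pair.\<close>

lemma five_numbers_from_half_values:
  fixes p q r e d N :: int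
  assumes odds: "\<And>m. odd m \<Longrightarrow> 1 \<le> m \<Longrightarrow> m \<le> 2 * N - 1 \<Longrightarrow> m \<in> A"
    and evens: "2 * p \<in> A" "2 * q \<in> A" "2 * r \<in> A" "2 * e \<in> A"
    and order: "p < q" "q < r" "1 \<le> d"
    and parity: "odd (p + q + r + e + d)"
    and lower: "1 + d \<le> p + q + e - r"
    and upper: "q + r + e - p + d \<le> 2 * N - 1"
  shows "\<exists>b :: nat \<Rightarrow> int. inj_on b {1..5} \<and>
           (\<forall>i j. 1 \<le> i \<and> i < j \<and> j \<le> 5 \<longrightarrow> b i + b j \<in> A)"
proof -
  let ?us = "[p + q - r, p + r - q, q + r - p]" and ?vs = "[e - d, e + d]"
  have mixed_odd: "odd (u + v)"
    if "u \<in> set ?us" "v \<in> set ?vs" for u v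
    using that parity by auto
  have mixed: "u + v \<in> A"
    if "u \<in> set ?us" "v \<in> set ?vs" for u v
  proof (rule odds)
    show "odd (u + v)"
      using that by (rule mixed_odd)
    show "1 \<le> u + v" "u + v \<le> 2 * N - 1"
      using that order lower upper by auto
  qed
  have "u \<noteq> v" if "u \<in> set ?us" "v \<in> set ?vs" for u v
    using mixed_odd[OF that] by auto
  then have "set ?us \<inter> set ?vs = {}"
    by blast
  moreover have "distinct ?us" "distinct ?vs"
    using order by simp_all
  ultimately have "distinct (?us @ ?vs)"
    unfolding distinct_append by blast
  moreover have "sorted_wrt (\<lambda>u v. u + v \<in> A) ?us" "sorted_wrt (\<lambda>u v. u + v \<in> A) ?vs"
    using evens by (simp_all add: algebra_simps)
  then have "sorted_wrt (\<lambda>u v. u + v \<in> A) (?us @ ?vs)"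
    unfolding sorted_wrt_append using mixed by blast
  ultimately show ?thesis
    by (intro five_numbers_from_list[of "?us @ ?vs"]) simp_all
qed

lemma five_numbers_from_four_half_values:
  fixes w x y z N :: int
  assumes odds: "\<And>m. odd m \<Longrightarrow> 1 \<le> m \<Longrightarrow> m \<le> 2 * N - 1 \<Longrightarrow> m \<in> A"
    and evens: "2 * w \<in> A" "2 * x \<in> A" "2 * y \<in> A" "2 * z \<in> A"
    and order: "1 \<le> w" "w < x" "x < y" "y < z" "z \<le> N"
  shows "\<exists>b :: nat \<Rightarrow> int. inj_on b {1..5} \<and>
           (\<forall>i j. 1 \<le> i \<and> i < j \<and> j \<le> 5 \<longrightarrow> b i + b j \<in> A)"
proof -
  define d :: int where "d = (if even (w + x + y + z) then 1 else 2)"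
  have d: "odd (w + x + y + z + d)" "d = 1 \<or> d = 2"
    by (auto simp: d_def)
  consider
      (low) "1 + d \<le> x + y + w - z"
    | (high) "x + y + w - z < 1 + d" "x + y + z - w + d \<le> 2 * N - 1"
    | (tight) "x + y + w - z < 1 + d" "2 * N - 1 < x + y + z - w + d"
    by linarith
  then show ?thesis
  proof cases
    case low
    \<comment> \<open>Only \<open>d = 2\<close> with both gaps \<open>x - w\<close> and
      \<open>z - y\<close> equal to 1 could break the bound, but then \<open>w + x + y + z\<close>
      is even, so \<open>d = 1\<close>.\<close>
    have "y + z + w - x + d \<le> 2 * N - 1"
    proof (cases "x = w + 1 \<and> z = y + 1")
      case True
      with d have "d = 1"
        by auto
      with True order show ?thesis
        by linarith
    next
      case False
      with d order show ?thesis
        by linarith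
    qed
    with low show ?thesis
      using evens order d
      by (intro five_numbers_from_half_values[OF odds, of N x y z w d]) (auto simp: ac_simps)
  next
    case high
    then show ?thesis
      using evens order d
      by (intro five_numbers_from_half_values[OF odds, of N w x y z d]) auto
  next
    case tight
    \<comment> \<open>Parity sharpens the two failed bounds to
      \<open>N + w \<le> k \<le> z + d - 1\<close>; with \<open>z \<le> N\<close> and
      \<open>d \<le> 2\<close> this forces equality throughout.\<close>
    obtain k where k: "w + x + y + z + d = 2 * k + 1"
      using d(1) by (rule oddE)
    with tight have "k < z + d" "N \<le> k - w"
      by linarith+
    with d(2) order have "w = 1" "d = 2" "k = z + 1" "z = N"
      by auto
    with k have "x + y = N"
      by simp
    define f :: int where "f = (if even x then 2 else 1)"
    have f: "odd (w + x + y + y + f)" "1 \<le> f" "f \<le> 2"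
      using \<open>w = 1\<close> by (auto simp: f_def)
    \<comment> \<open>Since \<open>w = 1\<close> and \<open>x + y = N\<close>, both range conditions
      reduce to \<open>f \<le> x\<close>, and \<open>x \<ge> 2\<close>.\<close>
    show ?thesis
      using evens order f \<open>w = 1\<close> \<open>x + y = N\<close>
      by (intro five_numbers_from_half_values[OF odds, of N w x y y f]) auto
  qed
qed

lemma four_increasing_elements:
  fixes S :: "'a::linorder set"
  assumes "card S \<ge> 4"
  obtains w x y z where "w \<in> S" "x \<in> S" "y \<in> S" "z \<in> S" "w < x" "x < y" "y < z"
proof -
  have "finite S"
    using assms by (metis card.infinite not_numeral_le_zero)
  define xs where "xs = sorted_list_of_set S"
  have xs: "sorted_wrt (<) xs" "set xs = S" "length xs \<ge> 4"
    using \<open>finite S\<close> assms by (simp_all add: xs_def)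
  show thesis
  proof (rule that)
    show "xs ! 0 \<in> S" "xs ! 1 \<in> S" "xs ! 2 \<in> S" "xs ! 3 \<in> S"
      unfolding xs(2)[symmetric] by (rule nth_mem, use xs(3) in linarith)+
    show "xs ! 0 < xs ! 1" "xs ! 1 < xs ! 2" "xs ! 2 < xs ! 3"
      by (rule sorted_wrt_nth_less[OF xs(1)], simp, use xs(3) in linarith)+
  qed
qed

theorem theorem7:
  fixes n :: nat and A :: "int set"
  assumes "n > 0"
    and "{2 * k - 1 | k. k \<in> {1..int n}} \<subset> A"
    and "A \<subseteq> {1..2 * int n}"
    and "card A \<ge> n + 4"
  shows "\<exists>b :: nat \<Rightarrow> int. inj_on b {1..5} \<and>
           (\<forall>i j. 1 \<le> i \<and> i < j \<and> j \<le> 5 \<longrightarrow> b i + b j \<in> A)"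
proof -
  have odds: "m \<in> A" if "odd m" "1 \<le> m" "m \<le> 2 * int n - 1" for m
  proof -
    from \<open>odd m\<close> obtain k where "m = 2 * k + 1"
      by (rule oddE)
    with that have "m = 2 * (k + 1) - 1" "k + 1 \<in> {1..int n}"
      by auto
    with assms(2) show ?thesis
      by blast
  qed
  define H where "H = {k \<in> {1..int n}. 2 * k \<in> A}"
  have "finite H"
    unfolding H_def by (rule finite_subset[of _ "{1..int n}"]) auto
  have "A \<subseteq> (\<lambda>k. 2 * k - 1) ` {1..int n} \<union> (*) 2 ` H"
  proof
    fix m
    assume "m \<in> A"
    with assms(3) have "1 \<le> m" "m \<le> 2 * int n"
      by auto
    show "m \<in> (\<lambda>k. 2 * k - 1) ` {1..int n} \<union> (*) 2 ` H"
    proof (cases "even m")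
      case True
      then obtain k where "m = 2 * k"
        by (rule evenE)
      with \<open>m \<in> A\<close> \<open>1 \<le> m\<close> \<open>m \<le> 2 * int n\<close> show ?thesis
        by (auto simp: H_def)
    next
      case False
      then obtain k where "m = 2 * k + 1"
        by (rule oddE)
      with \<open>1 \<le> m\<close> \<open>m \<le> 2 * int n\<close> have "m = 2 * (k + 1) - 1" "k + 1 \<in> {1..int n}"
        by auto
      then show ?thesis
        by blast
    qed
  qed
  \<comment> \<open>There are only \<open>n\<close> odd candidates, so at least four elements of
    \<open>A\<close> must come from \<open>H\<close>.\<close>
  then have "card A \<le> card ((\<lambda>k. 2 * k - 1) ` {1..int n} \<union> (*) 2 ` H)"
    using \<open>finite H\<close> by (intro card_mono) auto
  also have "\<dots> \<le> card ((\<lambda>k. 2 * k - 1) ` {1..int n}) + card ((*) 2 ` H)"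
    by (rule card_Un_le)
  also have "\<dots> \<le> card {1..int n} + card H"
    using \<open>finite H\<close> by (intro add_mono card_image_le) auto
  finally have "card H \<ge> 4"
    using assms(4) by simp
  then obtain w x y z where "w \<in> H" "x \<in> H" "y \<in> H" "z \<in> H" "w < x" "x < y" "y < z"
    by (rule four_increasing_elements)
  then show ?thesis
    by (intro five_numbers_from_four_half_values[OF odds, of "int n" w x y z]) (auto simp: H_def)
qed

end
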